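(* Let $k$ be a positive integer and $m,n$ positive integers with $mn<(4k+1)(4k+2)$. Then the graph of a $\{1,2k\}$-leaper on an $m\times n$ board has no Hamiltonian circuit.
   Context: For positive integers $r,s$, the graph of an $\{r,s\}$-leaper on an $m\times n$ board has vertex set $\{(x,y): 0\le x<m,\ 0\le y<n\}$ (integers), with an edge between $(x,y)$ and $(x',y')$ whenever $(x'-x,y'-y)\in\{(\pm r,\pm s),(\pm s,\pm r)\}$. A Hamiltonian circuit is a cycle passing through every vertex exactly once. *)

theory Defs
  imports "Graph_Theory.Graph_Theory"
begin

text \<open>
  An undirected graph is represented as a symmetric digraph: each edge appears as two
  opposite arcs.
\<close>

definition leaper_moves :: "nat \<Rightarrow> nat \<Rightarrow> (int \<times> int) set" where
  "leaper_moves r s =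
     {int r, - int r} \<times> {int s, - int s} \<union> {int s, - int s} \<times> {int r, - int r}"

definition leaper_graph :: "nat \<Rightarrow> nat \<Rightarrow> nat \<Rightarrow> nat \<Rightarrow> (int \<times> int) pair_pre_digraph" where
  "leaper_graph r s m n =
     (let V = {0..<int m} \<times> {0..<int n}
      in \<lparr> pverts = V,
           parcs = {((x, y), (x', y')) |x y x' y'.
             (x, y) \<in> V \<and> (x', y') \<in> V \<and> (x' - x, y' - y) \<in> leaper_moves r s} \<rparr>)"

lemma pair_graph_leaper_graph:
  assumes "r > 0" "s > 0"
  shows "pair_graph (leaper_graph r s m n)"
proof -
  have "parcs (leaper_graph r s m n) \<subseteq>
      ({0..<int m} \<times> {0..<int n}) \<times> ({0..<int m} \<times> {0..<int n})"
    by (auto simp: leaper_graph_def Let_def)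
  then have "finite (parcs (leaper_graph r s m n))"
    by (rule finite_subset) simp
  moreover have "sym (parcs (leaper_graph r s m n))"
    by (rule symI) (auto simp: leaper_graph_def leaper_moves_def Let_def)
  ultimately show ?thesis
    using assms
    by unfold_locales
      (auto simp: leaper_graph_def leaper_moves_def Let_def symmetric_def)
qed

text \<open>
  In a symmetric digraph, traversing an edge back and forth satisfies \<^const>\<open>pre_digraph.cycle\<close>,
  so a cycle of the underlying undirected graph additionally needs length at least 3.
  The vertices of a closed walk are the tails of its arcs; \<^const>\<open>pre_digraph.cycle\<close>
  already ensures that none of them is repeated.
\<close>

definition hamiltonian_circuit :: "('a, 'b) pre_digraph \<Rightarrow> 'b awalk \<Rightarrow> bool" where
  "hamiltonian_circuit G p \<longleftrightarrow>
     pre_digraph.cycle G p \<and> length p \<ge> 3 \<and> set (map (tail G) p) = verts G"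

end

theory Submission
  imports Defs
begin

text \<open>
  Write \<open>s = 2 k\<close> and suppose there are at most as many ranks as files. A board with at most \<open>s\<close>
  ranks has a disconnected graph; a board with both sides below \<open>2 s\<close> has an isolated cell; an odd board is
  excluded by the chessboard colouring. With exactly \<open>2 s\<close> ranks, a second colouring has an independent
  class of half the board, so a circuit would alternate in both colourings, which is impossible.
  With \<open>s < m < 2 s\<close> ranks and \<open>2 s < n < 4 s\<close> files, forced edges close a cycle of length 4.
  Given the area bound, only the board with \<open>s + 1\<close> ranks and \<open>4 s\<close> files is left.

  There, moves between ranks 0 and \<open>s\<close> (the rungs) change the file by 1, and all others change it by \<open>s\<close>.
  The edges at inner ranks are essentially forced and form zigzags across the board. The degree
  conditions then relate the rung at file \<open>y\<close> to the one at file \<open>y + 2 s\<close>, and the absence of short cycles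
  makes the rungs on the lowest \<open>s\<close> files periodic with period 4. Rotating the board by a half
  turn gives the same pattern on the highest \<open>s\<close> files, and the two patterns are incompatible.
\<close>

section \<open>Tours of a board\<close>

text \<open>A circuit is kept only as its edge relation: 2-regular and connected, the latter meaning
  that a closed set of cells that meets the board contains it. This form carries over to reflected
  boards, and short cycles contradict it directly.\<close>

locale leaper_tour =
  fixes s m n :: int and E :: "int \<times> int \<Rightarrow> int \<times> int \<Rightarrow> bool"
  assumes s_ge: "2 \<le> s" and s_even: "even s"
    and sym: "E u v \<Longrightarrow> E v u"
    and move: "E (x, y) (x', y') \<Longrightarrow> 0 \<le> x \<and> x < m \<and> 0 \<le> y \<and> y < n \<and>
      (\<bar>x' - x\<bar> = 1 \<and> \<bar>y' - y\<bar> = s \<or> \<bar>x' - x\<bar> = s \<and> \<bar>y' - y\<bar> = 1)"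
    and deg: "0 \<le> x \<Longrightarrow> x < m \<Longrightarrow> 0 \<le> y \<Longrightarrow> y < n \<Longrightarrow> card {w. E (x, y) w} = 2"
    and conn: "u \<in> S \<Longrightarrow> u \<in> {0..<m} \<times> {0..<n} \<Longrightarrow> (\<And>v w. v \<in> S \<Longrightarrow> E v w \<Longrightarrow> w \<in> S) \<Longrightarrow>
      {0..<m} \<times> {0..<n} \<subseteq> S"
begin

lemma commute: "E u v \<longleftrightarrow> E v u"
  using sym by blast

lemma move': "E (x, y) (x', y') \<Longrightarrow> 0 \<le> x \<and> x < m \<and> 0 \<le> y \<and> y < n \<and> 0 \<le> x' \<and> x' < m \<and> 0 \<le> y' \<and> y' < n \<and>
  ((x' = x + 1 \<or> x' = x - 1) \<and> (y' = y + s \<or> y' = y - s) \<or>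
   (x' = x + s \<or> x' = x - s) \<and> (y' = y + 1 \<or> y' = y - 1))"
  using move[of x y x' y'] move[of x' y' x y] sym[of "(x, y)" "(x', y')"] s_ge by linarith

lemma deg_sum:
  assumes "v \<in> {0..<m} \<times> {0..<n}" "finite C" "{w. E v w} \<subseteq> C"
  shows "(\<Sum>w\<in>C. of_bool (E v w)) = (2::int)"
proof -
  have "(\<Sum>w\<in>C. of_bool (E v w)) = (\<Sum>w\<in>{w. E v w}. (1::int))"
    using assms by (intro sum.mono_neutral_cong_right) auto
  then show ?thesis using assms deg by (cases v) auto
qed

lemma forced:
  assumes "v \<in> {0..<m} \<times> {0..<n}" "{w. E v w} \<subseteq> {a, b}"
  shows "E v a \<and> E v b"
proof -
  have "card {w. E v w} = 2" using assms deg by (cases v) auto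
  moreover have "card {a, b} \<le> 2" by (simp add: card_insert_if)
  ultimately have "{w. E v w} = {a, b}" using assms by (intro card_seteq) auto
  then show ?thesis by blast
qed

lemma no_third:
  assumes "E v a" "E v b" "a \<noteq> b" "E v w"
  shows "w = a \<or> w = b"
proof -
  obtain x y where v: "v = (x, y)" by (cases v)
  obtain x' y' where a: "a = (x', y')" by (cases a)
  have c: "card {w. E v w} = 2" using assms(1) move[of x y x' y'] deg[of x y] v a by auto
  then have "finite {w. E v w}" by (simp add: card_ge_0_finite)
  then have "{a, b} = {w. E v w}" using assms c by (intro card_seteq) auto
  then show ?thesis using assms(4) by blast
qed

definition both_nbrs_in :: "(int \<times> int) set \<Rightarrow> int \<times> int \<Rightarrow> bool" where
  "both_nbrs_in S v \<longleftrightarrow> (\<exists>a\<in>S. \<exists>b\<in>S. a \<noteq> b \<and> E v a \<and> E v b)"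

lemma both_nbrs_inI:
  "E v a \<Longrightarrow> E v b \<Longrightarrow> a \<noteq> b \<Longrightarrow> a \<in> S \<Longrightarrow> b \<in> S \<Longrightarrow> both_nbrs_in S v"
  unfolding both_nbrs_in_def by blast

text \<open>Since degrees are 2, two distinct neighbours in \<open>S\<close> are all the neighbours,
  so \<open>S\<close> is closed. Applied to the cells of a short cycle, this contradicts the size of
  the board.\<close>

lemma closed_eq_board:
  assumes "u \<in> S" "u \<in> {0..<m} \<times> {0..<n}"
    and "\<And>x y. (x, y) \<in> S \<Longrightarrow> both_nbrs_in S (x, y)"
  shows "{0..<m} \<times> {0..<n} \<subseteq> S"
proof (rule conn[OF assms(1,2)])
  fix v w assume "v \<in> S" "E v w"
  moreover from assms(3)[of "fst v" "snd v"] \<open>v \<in> S\<close>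
  obtain a b where "a \<in> S" "b \<in> S" "a \<noteq> b" "E v a" "E v b"
    by (auto simp: both_nbrs_in_def)
  ultimately show "w \<in> S" using no_third by metis
qed


section \<open>Colouring arguments\<close>

text \<open>Double counting: each cell has two outgoing arcs, and the reversals of the arcs leaving
  \<open>A\<close> are among the arcs leaving the complement. If the sizes agree, the two sets of
  arcs coincide.\<close>

lemma independent_card:
  assumes "A \<subseteq> {0..<m} \<times> {0..<n}" "\<And>u v. u \<in> A \<Longrightarrow> v \<in> A \<Longrightarrow> \<not> E u v"
  shows "card A \<le> card ({0..<m} \<times> {0..<n} - A)"
    and "card ({0..<m} \<times> {0..<n} - A) \<le> card A \<Longrightarrow> E u v \<Longrightarrow> u \<notin> A \<Longrightarrow> v \<in> A"
proof -
  let ?V = "{0..<m} \<times> {0..<n}"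
  have fin: "finite ?V" "finite A" using finite_subset[OF assms(1)] by auto
  have fE: "finite {w. E v w}" if "v \<in> ?V" for v
  proof -
    have "card {w. E v w} = 2" using that deg by (cases v) auto
    then show ?thesis by (simp add: card_ge_0_finite)
  qed
  have count: "card (Sigma B (\<lambda>v. {w. E v w})) = 2 * card B" if "B \<subseteq> ?V" for B
  proof -
    have "finite B" using that fin finite_subset by auto
    then have "card (Sigma B (\<lambda>v. {w. E v w})) = (\<Sum>v\<in>B. card {w. E v w})"
      using that fE by (intro card_SigmaI) auto
    also have "\<dots> = (\<Sum>v\<in>B. 2)" using that deg by (intro sum.cong) auto
    finally show ?thesis by simp
  qed
  have inV: "E u v \<Longrightarrow> u \<in> ?V" for u v
    using move[of "fst u" "snd u" "fst v" "snd v"] by (cases u; cases v) auto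
  let ?X = "prod.swap ` Sigma A (\<lambda>v. {w. E v w})"
  let ?Y = "Sigma (?V - A) (\<lambda>v. {w. E v w})"
  have sub: "?X \<subseteq> ?Y"
  proof
    fix p assume "p \<in> ?X"
    then obtain u v where p: "p = (v, u)" "u \<in> A" "E u v" by auto
    then have "E v u" "v \<notin> A" using sym assms(2) by blast+
    then show "p \<in> ?Y" using p inV[of v u] by blast
  qed
  have finY: "finite ?Y" using fin fE by (intro finite_SigmaI) auto
  have cX: "card ?X = 2 * card A" using count[OF assms(1)] by (subst card_image) auto
  have cY: "card ?Y = 2 * card (?V - A)" by (intro count) auto
  show "card A \<le> card (?V - A)" using card_mono[OF finY sub] cX cY by simp
  assume "card (?V - A) \<le> card A" "E u v" "u \<notin> A"
  then have "?X = ?Y" using finY sub cX cY by (intro card_seteq) auto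
  moreover have "(u, v) \<in> ?Y" using \<open>E u v\<close> \<open>u \<notin> A\<close> inV[of u v] by simp
  ultimately have "(u, v) \<in> ?X" by metis
  then show "v \<in> A" by auto
qed

lemma even_card: "even (card ({0..<m} \<times> {0..<n}))"
proof -
  let ?V = "{0..<m} \<times> {0..<n}"
  let ?A = "{v \<in> ?V. even (fst v + snd v)}"
  let ?B = "{v \<in> ?V. odd (fst v + snd v)}"
  have par: "even (fst u + snd u) \<noteq> even (fst v + snd v)" if "E u v" for u v
    using move'[of "fst u" "snd u" "fst v" "snd v"] s_even that by auto
  have "?V - ?A = ?B" "?V - ?B = ?A" by auto
  moreover have "card ?A \<le> card (?V - ?A)" by (intro independent_card) (use par in auto)
  moreover have "card ?B \<le> card (?V - ?B)" by (intro independent_card) (use par in auto)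
  ultimately have "card ?A = card ?B" by simp
  moreover have "card ?V = card ?A + card ?B"
    using \<open>?V - ?A = ?B\<close> card_Diff_subset[of ?A ?V] card_mono[of ?V ?A] by auto
  ultimately show ?thesis by simp
qed

lemma not_double_width:
  assumes "m = 2 * s" "2 \<le> n"
  shows False
proof -
  let ?V = "{0..<m} \<times> {0..<n}"
  \<comment> \<open>A rank change by 1 within a half of the board flips the rank parity, one by
    \<open>s\<close> swaps the halves, and ranks \<open>s - 1\<close> and \<open>s\<close> lie
    outside \<open>A\<close>; hence \<open>A\<close> is independent.\<close>
  define A where "A = {v \<in> ?V. even (fst v) = (fst v < s)}"
  \<comment> \<open>Each edge flips both membership in \<open>A\<close> and the chessboard colour,
    so the cells where the two agree form a closed set.\<close>
  define S where "S = {v. (v \<in> A) = even (fst v + snd v)}"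
  have ind: "\<not> E u v" if "u \<in> A" "v \<in> A" for u v
    using move'[of "fst u" "snd u" "fst v" "snd v"] that s_even assms(1)
    unfolding A_def
    by (cases "even (fst u)"; cases "even (fst v)") (auto, presburger+)
  let ?g = "\<lambda>(x, y). (if x < s then x + s else x - s, y :: int)"
  have "card (?V - A) \<le> card A"
  proof (rule card_inj_on_le[where f = ?g])
    show "inj_on ?g (?V - A)" by (use assms(1) in \<open>auto simp: inj_on_def split: if_splits\<close>)
    show "?g ` (?V - A) \<subseteq> A" using s_even assms(1) by (auto simp: A_def split: if_splits)
    show "finite A" by (auto simp: A_def intro: finite_subset)
  qed
  then have alt: "u \<in> A \<longleftrightarrow> v \<notin> A" if "E u v" for u v
    using independent_card(2)[of A u v] ind that by (auto simp: A_def)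
  have par: "even (fst u + snd u) \<noteq> even (fst v + snd v)" if "E u v" for u v
    using move'[of "fst u" "snd u" "fst v" "snd v"] s_even that by auto
  have "?V \<subseteq> S"
  proof (rule conn[where u = "(0, 0)"])
    show "w \<in> S" if "v \<in> S" "E v w" for v w
      using that alt par unfolding S_def by blast
  qed (use assms s_ge in \<open>auto simp: S_def A_def\<close>)
  moreover have "(0, 1) \<in> ?V" "(0, 1) \<notin> S" using assms s_ge by (auto simp: S_def A_def)
  ultimately show False by blast
qed


section \<open>Narrow boards\<close>

lemma more_ranks_than_s:
  assumes "m \<le> n" "0 < m" shows "s < m"
proof (rule ccontr)
  assume "\<not> s < m"
  then have ms: "m \<le> s" by simp
  have "n \<noteq> 1"
  proof
    assume "n = 1"
    then have "{w. E (0, 0) w} = {}" using move'[of 0 0] assms ms s_ge by force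
    moreover have "card {w. E (0, 0) w} = 2" using deg assms by simp
    ultimately show False by (metis card.empty zero_neq_numeral)
  qed
  \<comment> \<open>With at most \<open>s\<close> ranks no move changes the rank by
    \<open>s\<close>, so every move preserves the file modulo \<open>s\<close>.\<close>
  define S where "S = {v :: int \<times> int. s dvd snd v}"
  have "{0..<m} \<times> {0..<n} \<subseteq> S"
  proof (rule conn[where u = "(0, 0)"])
    show "w \<in> S" if "v \<in> S" "E v w" for v w
      using that move'[of "fst v" "snd v" "fst w" "snd w"] ms s_ge by (auto simp: S_def)
  qed (use assms in \<open>auto simp: S_def\<close>)
  then have "(0, 1) \<in> S" using assms \<open>n \<noteq> 1\<close> by auto
  then show False using s_ge by (simp add: S_def)
qed

lemma not_both_narrow:
  assumes "s < m" "s < n" "m < 2 * s" "n < 2 * s"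
  shows False
proof -
  have "{w. E (s - 1, s - 1) w} = {}" using move'[of "s - 1" "s - 1"] assms s_ge by force
  moreover have "card {w. E (s - 1, s - 1) w} = 2" using deg assms s_ge by simp
  ultimately show False by (metis card.empty zero_neq_numeral)
qed

text \<open>A file class modulo \<open>s\<close> with exactly three files \<open>y\<close>, \<open>y + s\<close>, \<open>y + 2 s\<close> forces a cycle of length 4.\<close>

lemma not_three_files:
  assumes "s < m" "m < 2 * s" "2 * s < n" "n < 4 * s"
  shows False
proof -
  define y where "y = (if n \<le> 3 * s then 0 else s - 1)"
  have y: "0 \<le> y" "y < s" "y + 2 * s < n" "n \<le> y + 3 * s"
    using assms s_ge by (auto simp: y_def)
  define S where "S = {(s - 1, y), (s - 1, y + 2 * s), (s - 2, y + s), (s, y + s)}"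
  \<comment> \<open>With fewer than \<open>2 * s\<close> ranks, no move from rank
    \<open>s - 1\<close> changes the rank by \<open>s\<close>.\<close>
  have "{w. E (s - 1, y) w} \<subseteq> {(s - 2, y + s), (s, y + s)}"
    using move'[of "s - 1" y] assms y by force
  then have e1: "E (s - 1, y) (s - 2, y + s) \<and> E (s - 1, y) (s, y + s)"
    by (rule forced[rotated]) (use assms y s_ge in auto)
  have "{w. E (s - 1, y + 2 * s) w} \<subseteq> {(s - 2, y + s), (s, y + s)}"
    using move'[of "s - 1" "y + 2 * s"] assms y by force
  then have e2: "E (s - 1, y + 2 * s) (s - 2, y + s) \<and> E (s - 1, y + 2 * s) (s, y + s)"
    by (rule forced[rotated]) (use assms y s_ge in auto)
  have "{0..<m} \<times> {0..<n} \<subseteq> S"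
  proof (rule closed_eq_board)
    show "(s - 1, y) \<in> S" "(s - 1, y) \<in> {0..<m} \<times> {0..<n}"
      using assms y s_ge by (auto simp: S_def)
    show "both_nbrs_in S (x, z)" if xz: "(x, z) \<in> S" for x z
    proof -
      consider "x = s - 1" "z = y" | "x = s - 1" "z = y + 2 * s" | "x = s - 2" "z = y + s" | "x = s" "z = y + s"
        using xz unfolding S_def by simp blast
      then show ?thesis
      proof cases
        case 1
        then show ?thesis using e1
          by (intro both_nbrs_inI[of _ "(s - 2, y + s)" "(s, y + s)"]) (auto simp: S_def)
      next
        case 2
        then show ?thesis using e2
          by (intro both_nbrs_inI[of _ "(s - 2, y + s)" "(s, y + s)"]) (auto simp: S_def)
      next
        case 3
        then show ?thesis using e1 e2
          by (intro both_nbrs_inI[of _ "(s - 1, y)" "(s - 1, y + 2 * s)"])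
            (use s_ge in \<open>auto simp: S_def commute[of "(s - 2, y + s)"] commute[of "(s, y + s)"]\<close>)
      next
        case 4
        then show ?thesis using e1 e2
          by (intro both_nbrs_inI[of _ "(s - 1, y)" "(s - 1, y + 2 * s)"])
            (use s_ge in \<open>auto simp: S_def commute[of "(s - 2, y + s)"] commute[of "(s, y + s)"]\<close>)
      qed
    qed
  qed
  moreover have "(s - 1, y + s) \<in> {0..<m} \<times> {0..<n}" using assms y s_ge by auto
  moreover have "(s - 1, y + s) \<notin> S" using s_ge by (auto simp: S_def)
  ultimately show False by blast
qed

end

section \<open>Symmetries of the board\<close>

text \<open>An involution is its own inverse, so neighbourhoods and closed sets transport along
  \<open>f\<close> both ways. This covers transposition and both reflections.\<close>

lemma leaper_tour_vimage:
  assumes tour: "leaper_tour s m n E"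
    and bij: "\<And>v. f (f v) = v"
    and maps: "\<And>v. v \<in> {0..<m'} \<times> {0..<n'} \<longleftrightarrow> f v \<in> {0..<m} \<times> {0..<n}"
    and leap: "\<And>x y x' y' a b a' b'. f (x, y) = (a, b) \<Longrightarrow> f (x', y') = (a', b') \<Longrightarrow>
      \<bar>a' - a\<bar> = 1 \<and> \<bar>b' - b\<bar> = s \<or> \<bar>a' - a\<bar> = s \<and> \<bar>b' - b\<bar> = 1 \<Longrightarrow>
      \<bar>x' - x\<bar> = 1 \<and> \<bar>y' - y\<bar> = s \<or> \<bar>x' - x\<bar> = s \<and> \<bar>y' - y\<bar> = 1"
  shows "leaper_tour s m' n' (\<lambda>u v. E (f u) (f v))"
proof -
  interpret leaper_tour s m n E by (rule tour)
  show ?thesis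
  proof
    show "2 \<le> s" "even s" by (rule s_ge s_even)+
    show "E (f v) (f u)" if "E (f u) (f v)" for u v by (rule sym[OF that])
    show "0 \<le> x \<and> x < m' \<and> 0 \<le> y \<and> y < n' \<and>
        (\<bar>x' - x\<bar> = 1 \<and> \<bar>y' - y\<bar> = s \<or> \<bar>x' - x\<bar> = s \<and> \<bar>y' - y\<bar> = 1)"
      if "E (f (x, y)) (f (x', y'))" for x y x' y'
      using that maps[of "(x, y)"] leap[of x y _ _ x' y'] move
      by (cases "f (x, y)"; cases "f (x', y')") force
    show "card {w. E (f (x, y)) (f w)} = 2" if "0 \<le> x" "x < m'" "0 \<le> y" "y < n'" for x y
    proof -
      have "{w. E (f (x, y)) w} = f ` {w. E (f (x, y)) (f w)}"
      proof (intro equalityI subsetI)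
        fix w assume "w \<in> {w. E (f (x, y)) w}"
        then have "f w \<in> {w. E (f (x, y)) (f w)}" by (simp add: bij)
        then show "w \<in> f ` {w. E (f (x, y)) (f w)}" by (metis bij imageI)
      qed auto
      moreover have "inj_on f A" for A using bij by (metis inj_onI)
      ultimately have "card {w. E (f (x, y)) w} = card {w. E (f (x, y)) (f w)}"
        by (simp add: card_image)
      then show ?thesis using deg maps[of "(x, y)"] that by (cases "f (x, y)") auto
    qed
    show "{0..<m'} \<times> {0..<n'} \<subseteq> S"
      if u: "u \<in> S" "u \<in> {0..<m'} \<times> {0..<n'}" and c: "\<And>v w. v \<in> S \<Longrightarrow> E (f v) (f w) \<Longrightarrow> w \<in> S"
      for u S
    proof -
      have "{0..<m} \<times> {0..<n} \<subseteq> f ` S"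
      proof (rule conn)
        show "f u \<in> f ` S" using u by simp
        show "f u \<in> {0..<m} \<times> {0..<n}" using u maps by blast
        fix v w assume "v \<in> f ` S" "E v w"
        then have "f w \<in> S" using c[of "f v" "f w"] bij by auto
        then show "w \<in> f ` S" using bij by (metis imageI)
      qed
      moreover have "p \<in> S" if "f p \<in> f ` S" for p
        using that bij by (metis imageE)
      ultimately show ?thesis using maps by blast
    qed
  qed
qed

lemma leaper_tour_transpose:
  assumes "leaper_tour s m n E"
  shows "leaper_tour s n m (\<lambda>u v. E (prod.swap u) (prod.swap v))"
  using assms by (rule leaper_tour_vimage) auto

lemma leaper_tour_flip_ranks:
  assumes "leaper_tour s m n E"
  shows "leaper_tour s m n (\<lambda>u v. E (m - 1 - fst u, snd u) (m - 1 - fst v, snd v))"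
  using assms by (rule leaper_tour_vimage[where f = "\<lambda>v. (m - 1 - fst v, snd v)"]) auto

lemma leaper_tour_flip_files:
  assumes "leaper_tour s m n E"
  shows "leaper_tour s m n (\<lambda>u v. E (fst u, n - 1 - snd u) (fst v, n - 1 - snd v))"
  using assms by (rule leaper_tour_vimage[where f = "\<lambda>v. (fst v, n - 1 - snd v)"]) auto

section \<open>The board with \<open>s + 1\<close> ranks and \<open>4 s\<close> files\<close>

locale leaper_strip = leaper_tour s "s + 1" "4 * s" E
  for s :: int and E
begin

lemma low_forced:
  assumes "0 < x" "x < s" "0 \<le> y" "y < s"
  shows "E (x, y) (x - 1, y + s) \<and> E (x, y) (x + 1, y + s)"
proof (rule forced)
  show "{w. E (x, y) w} \<subseteq> {(x - 1, y + s), (x + 1, y + s)}"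
    using move'[of x y] assms by force
qed (use assms in auto)

lemma high_forced:
  assumes "0 < x" "x < s" "3 * s \<le> y" "y < 4 * s"
  shows "E (x, y) (x - 1, y - s) \<and> E (x, y) (x + 1, y - s)"
proof (rule forced)
  show "{w. E (x, y) w} \<subseteq> {(x - 1, y - s), (x + 1, y - s)}"
    using move'[of x y] assms by force
qed (use assms in auto)

lemma deg_first_rank:
  assumes "0 \<le> y" "y < 4 * s"
  shows "of_bool (E (0, y) (1, y - s)) + of_bool (E (0, y) (1, y + s)) +
    of_bool (E (0, y) (s, y - 1)) + of_bool (E (0, y) (s, y + 1)) = (2::int)"
proof -
  have "(\<Sum>w\<in>{(1, y - s), (1, y + s), (s, y - 1), (s, y + 1)}. of_bool (E (0, y) w)) = (2::int)"
    by (rule deg_sum) (use move'[of 0 y] assms s_ge in force)+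
  then show ?thesis using s_ge by (simp del: sum_of_bool_eq)
qed

text \<open>Cells of inner ranks have only two neighbours if they lie on the lowest \<open>s\<close> or the highest \<open>s\<close>
  files. The edges forced in this way make up the paths \<open>zig y\<close>, which alternate between \<open>y\<close> and
  such a file, and all of \<open>zag a b c\<close> but its two end edges, which lead to the files \<open>a\<close> and \<open>b\<close>.\<close>

definition zig :: "int \<Rightarrow> int \<Rightarrow> int" where
  "zig y x = (if even x then y else if y < 2 * s then y - s else y + s)"

lemma zig_path:
  assumes "s \<le> y" "y < 3 * s" "0 \<le> x" "x < s"
  shows "E (x, zig y x) (x + 1, zig y (x + 1))"
proof (cases "even x")
  case True
  then have "x + 1 < s" using assms s_even by presburger
  then show ?thesis
    using True low_forced[of "x + 1" "y - s"] high_forced[of "x + 1" "y + s"] assms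
    by (subst commute) (auto simp: zig_def)
next
  case False
  then have "0 < x" using assms by presburger
  then show ?thesis
    using False low_forced[of x "y - s"] high_forced[of x "y + s"] assms
    by (auto simp: zig_def)
qed

definition zag :: "int \<Rightarrow> int \<Rightarrow> int \<Rightarrow> int \<Rightarrow> int" where
  "zag a b c x = (if x = 0 then a else if x = s then b else if even x then c else c + s)"

lemma zag_path:
  assumes "0 \<le> c" "c < s" "0 \<le> x" "x < s"
    and ends: "E (0, a) (1, c + s)" "E (s, b) (s - 1, c + s)"
  shows "E (x, zag a b c x) (x + 1, zag a b c (x + 1))"
proof -
  consider "x = 0" | "x = s - 1" | "0 < x" "x < s - 1" using assms by linarith
  then show ?thesis
  proof cases
    case 1
    then show ?thesis using ends s_ge by (auto simp: zag_def)
  next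
    case 2
    then show ?thesis using sym[OF ends(2)] s_ge s_even by (auto simp: zag_def)
  next
    case 3
    then show ?thesis
      using low_forced[of x c] low_forced[of "x + 1" c] assms(1,2)
      by (auto simp: zag_def commute[of _ "(x + 1, c)"])
  qed
qed

section \<open>Short cycles made of zigzag paths\<close>

text \<open>Each path meets rank 0 in a single cell, but a closed union would have to contain all
  \<open>4 * s\<close> cells of that rank, which are at least 8.\<close>

lemma paths_not_closed:
  assumes "finite F" "card F \<le> 4" "f \<in> F"
    and path: "\<And>f x. f \<in> F \<Longrightarrow> 0 \<le> x \<Longrightarrow> x < s \<Longrightarrow> E (x, f x) (x + 1, f (x + 1))"
    and ends: "\<And>f. f \<in> F \<Longrightarrow> both_nbrs_in (\<Union>f\<in>F. (\<lambda>x. (x, f x)) ` {0..s}) (0, f 0)"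
      "\<And>f. f \<in> F \<Longrightarrow> both_nbrs_in (\<Union>f\<in>F. (\<lambda>x. (x, f x)) ` {0..s}) (s, f s)"
  shows False
proof -
  define S where "S = (\<Union>f\<in>F. (\<lambda>x. (x, f x)) ` {0..s})"
  have S: "(x, f x) \<in> S" if "f \<in> F" "0 \<le> x" "x \<le> s" for f x
    unfolding S_def by (intro UN_I[OF that(1)] imageI) (use that in simp)
  have "{0..<s + 1} \<times> {0..<4 * s} \<subseteq> S"
  proof (rule closed_eq_board)
    show "(0, f 0) \<in> S" using S assms s_ge by simp
    show "(0, f 0) \<in> {0..<s + 1} \<times> {0..<4 * s}"
      using path[of f 0] move[of 0 "f 0"] assms s_ge by simp
    show "both_nbrs_in S (x, z)" if xz: "(x, z) \<in> S" for x z
    proof -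
      obtain g where g: "g \<in> F" "z = g x" "0 \<le> x" "x \<le> s" using xz by (auto simp: S_def)
      consider "x = 0" | "x = s" | "0 < x" "x < s" using g by linarith
      then show ?thesis
      proof cases
        case 3
        show ?thesis
        proof (rule both_nbrs_inI)
          show "E (x, z) (x + 1, g (x + 1))" using path g 3 by simp
          show "E (x, z) (x - 1, g (x - 1))" using sym[OF path[of g "x - 1"]] g 3 by simp
        qed (use S g 3 in auto)
      qed (use ends[OF g(1)] g in \<open>auto simp: S_def\<close>)
    qed
  qed
  then have "(\<lambda>y. (0, y)) ` {0..<4 * s} \<subseteq> S" using s_ge by auto
  then have "{0..<4 * s} \<subseteq> (\<lambda>f. f 0) ` F" by (force simp: S_def)
  then have "card {0..<4 * s} \<le> card F"
    using assms(1) by (meson card_image_le card_mono finite_imageI order_trans)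
  then show False using assms(2) s_ge by simp
qed

lemma no_cycle_of_two_paths:
  assumes path: "\<And>x. 0 \<le> x \<Longrightarrow> x < s \<Longrightarrow> E (x, f x) (x + 1, f (x + 1))"
      "\<And>x. 0 \<le> x \<Longrightarrow> x < s \<Longrightarrow> E (x, g x) (x + 1, g (x + 1))"
    and link: "E (0, f 0) (s, g s)" "E (s, f s) (0, g 0)"
  shows False
proof (rule paths_not_closed[of "{f, g}" f])
  let ?S = "\<Union>f\<in>{f, g}. (\<lambda>x. (x, f x)) ` {0..s}"
  have mem: "(x, f x) \<in> ?S" "(x, g x) \<in> ?S" if "0 \<le> x" "x \<le> s" for x
    using that by auto
  show "E (x, h x) (x + 1, h (x + 1))" if "h \<in> {f, g}" "0 \<le> x" "x < s" for h x
    using that path by auto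
  have "both_nbrs_in ?S (0, f 0)"
    by (rule both_nbrs_inI[of _ "(1, f 1)" "(s, g s)"]) (use path[of 0] link mem s_ge in auto)
  moreover have "both_nbrs_in ?S (0, g 0)"
    by (rule both_nbrs_inI[of _ "(1, g 1)" "(s, f s)"])
      (use path[of 0] sym[OF link(2)] mem s_ge in auto)
  ultimately show "both_nbrs_in ?S (0, h 0)" if "h \<in> {f, g}" for h
    using that by blast
  have "both_nbrs_in ?S (s, f s)"
    by (rule both_nbrs_inI[of _ "(s - 1, f (s - 1))" "(0, g 0)"])
      (use sym[OF path(1)[of "s - 1"]] link mem s_ge in auto)
  moreover have "both_nbrs_in ?S (s, g s)"
    by (rule both_nbrs_inI[of _ "(s - 1, g (s - 1))" "(0, f 0)"])
      (use sym[OF path(2)[of "s - 1"]] sym[OF link(1)] mem s_ge in auto)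
  ultimately show "both_nbrs_in ?S (s, h s)" if "h \<in> {f, g}" for h
    using that by blast
qed (use s_ge in \<open>auto simp: card_insert_if\<close>)

lemma zig_ends: "zig y 0 = y" "zig y s = y"
  using s_even by (auto simp: zig_def)

lemma zag_ends: "zag a b c 0 = a" "zag a b c s = b"
  using s_ge by (auto simp: zag_def)

lemma no_zig_cycle:
  assumes "s \<le> y" "y + 1 < 3 * s" "E (0, y) (s, y + 1)" "E (s, y) (0, y + 1)"
  shows False
  by (rule no_cycle_of_two_paths[of "zig y" "zig (y + 1)"])
    (use zig_path[of y] zig_path[of "y + 1"] assms in \<open>auto simp: zig_ends\<close>)

lemma no_zag_cycle:
  assumes "0 \<le> c" "c + 1 < s" "E (0, c) (s, c + 1)" "E (s, c) (0, c + 1)"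
    and "E (0, c) (1, c + s)" "E (s, c) (s - 1, c + s)"
    and "E (0, c + 1) (1, c + 1 + s)" "E (s, c + 1) (s - 1, c + 1 + s)"
  shows False
  by (rule no_cycle_of_two_paths[of "zag c c c" "zag (c + 1) (c + 1) (c + 1)"])
    (use zag_path[of c _ c c] zag_path[of "c + 1" _ "c + 1" "c + 1"] assms
      in \<open>auto simp: zag_ends\<close>)

text \<open>The excluded cycle runs along \<open>f1\<close> from \<open>(0, c + 2 * s)\<close> to
  \<open>(s, c)\<close>, by a rung to \<open>(0, c + 1)\<close>, along \<open>f4\<close> and then
  \<open>f3\<close> backwards to \<open>(0, c + 1 + 2 * s)\<close>, by a rung to
  \<open>(s, c + 2 * s)\<close>, and back along \<open>f2\<close>.\<close>

lemma no_zig_zag_cycle: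
  assumes c: "0 \<le> c" "c + 1 < s"
    and link: "E (s, c) (0, c + 1)" "E (s, c + 2 * s) (0, c + 1 + 2 * s)"
    and left: "E (0, c + 2 * s) (1, c + s)" "E (s, c) (s - 1, c + s)"
    and right: "E (0, c + 1) (1, c + 1 + s)" "E (s, c + 1 + 2 * s) (s - 1, c + 1 + s)"
  shows False
proof -
  define f1 where "f1 = zag (c + 2 * s) c c"
  define f2 where "f2 = zig (c + 2 * s)"
  define f3 where "f3 = zig (c + 1 + 2 * s)"
  define f4 where "f4 = zag (c + 1) (c + 1 + 2 * s) (c + 1)"
  let ?F = "{f1, f2, f3, f4}"
  let ?S = "\<Union>f\<in>?F. (\<lambda>x. (x, f x)) ` {0..s}"
  have path: "E (x, f x) (x + 1, f (x + 1))" if "f \<in> ?F" "0 \<le> x" "x < s" for f x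
    using that zag_path[of c x "c + 2 * s" c] zag_path[of "c + 1" x "c + 1" "c + 1 + 2 * s"]
      zig_path[of "c + 2 * s" x] zig_path[of "c + 1 + 2 * s" x] c left right
    by (auto simp: f1_def f2_def f3_def f4_def)
  have first: "E (0, f 0) (1, f 1)" if "f \<in> ?F" for f
    using path[of f 0] that s_ge by simp
  have last: "E (s, f s) (s - 1, f (s - 1))" if "f \<in> ?F" for f
    using sym[OF path[of f "s - 1"]] that s_ge by simp
  have mem: "(x, f x) \<in> ?S" if "f \<in> ?F" "0 \<le> x" "x \<le> s" for f x
    by (intro UN_I[OF that(1)] imageI) (use that in simp)
  have ends: "f1 0 = c + 2 * s" "f1 s = c" "f2 0 = c + 2 * s" "f2 s = c + 2 * s"
    "f3 0 = c + 1 + 2 * s" "f3 s = c + 1 + 2 * s" "f4 0 = c + 1" "f4 s = c + 1 + 2 * s"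
    by (simp_all add: f1_def f2_def f3_def f4_def zig_ends zag_ends)
  have one: "odd (s - 1)" "s - 1 \<noteq> 0" using s_even s_ge by auto
  have inner: "f1 1 = c + s" "f2 1 = c + 3 * s"
    "f3 (s - 1) = c + 1 + 3 * s" "f4 (s - 1) = c + 1 + s"
    using c s_ge one by (simp_all add: f1_def f2_def f3_def f4_def zig_def zag_def)
  have F: "f1 \<in> ?F" "f2 \<in> ?F" "f3 \<in> ?F" "f4 \<in> ?F" by auto
  have d: "both_nbrs_in ?S (0, f 0)"
    if "f \<in> ?F" "g \<in> ?F" "E (0, f 0) (s, g s)" for f g
    by (rule both_nbrs_inI[OF first[OF that(1)] that(3)])
      (use mem[OF that(1), of 1] mem[OF that(2), of s] s_ge in auto)
  have e: "both_nbrs_in ?S (s, f s)"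
    if "f \<in> ?F" "g \<in> ?F" "E (s, f s) (0, g 0)" for f g
    by (rule both_nbrs_inI[OF last[OF that(1)] that(3)])
      (use mem[OF that(1), of "s - 1"] mem[OF that(2), of 0] s_ge in auto)
  \<comment> \<open>Here \<open>f1\<close> and \<open>f2\<close> meet without a rung;
    \<open>f3\<close> and \<open>f4\<close> do so at \<open>(s, c + 1 + 2 * s)\<close>.\<close>
  have "both_nbrs_in ?S (0, c + 2 * s)"
    by (rule both_nbrs_inI[of _ "(1, f1 1)" "(1, f2 1)"])
      (use first[OF F(1)] first[OF F(2)] mem[OF F(1), of 1] mem[OF F(2), of 1] s_ge
        in \<open>auto simp: ends inner\<close>)
  moreover have "both_nbrs_in ?S (0, f3 0)" "both_nbrs_in ?S (0, f4 0)"
    using d[OF F(3,2)] d[OF F(4,1)] sym[OF link(1)] sym[OF link(2)] by (simp_all only: ends)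
  ultimately have start: "both_nbrs_in ?S (0, f 0)" if "f \<in> ?F" for f
    using that ends(1,3) by auto
  have "both_nbrs_in ?S (s, c + 1 + 2 * s)"
    by (rule both_nbrs_inI[of _ "(s - 1, f3 (s - 1))" "(s - 1, f4 (s - 1))"])
      (use last[OF F(3)] last[OF F(4)] mem[OF F(3), of "s - 1"] mem[OF F(4), of "s - 1"] s_ge
        in \<open>auto simp: ends inner\<close>)
  moreover have "both_nbrs_in ?S (s, f1 s)" "both_nbrs_in ?S (s, f2 s)"
    using e[OF F(1,4)] e[OF F(2,3)] link by (simp_all only: ends)
  ultimately have finish: "both_nbrs_in ?S (s, f s)" if "f \<in> ?F" for f
    using that ends(6,8) by auto
  show False
  proof (rule paths_not_closed[of ?F f1])
    show "E (x, f x) (x + 1, f (x + 1))" if "f \<in> ?F" "0 \<le> x" "x < s" for f x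
      using path that by blast
    show "both_nbrs_in ?S (0, f 0)" "both_nbrs_in ?S (s, f s)" if "f \<in> ?F" for f
      using start finish that by blast+
  qed (auto simp: card_insert_if)
qed

section \<open>Degree relations between files \<open>y\<close> and \<open>y + 2 * s\<close>\<close>

lemma strip_flip_ranks: "leaper_strip s (\<lambda>u v. E (s - fst u, snd u) (s - fst v, snd v))"
  using leaper_tour_flip_ranks[OF leaper_tour_axioms] by (simp add: leaper_strip_def)

lemma strip_flip_files:
  "leaper_strip s (\<lambda>u v. E (fst u, 4 * s - 1 - snd u) (fst v, 4 * s - 1 - snd v))"
  using leaper_tour_flip_files[OF leaper_tour_axioms] by (simp add: leaper_strip_def)

lemma deg_last_rank:
  assumes "0 \<le> y" "y < 4 * s"
  shows "of_bool (E (s, y) (s - 1, y - s)) + of_bool (E (s, y) (s - 1, y + s)) +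
    of_bool (E (s, y) (0, y - 1)) + of_bool (E (s, y) (0, y + 1)) = (2::int)"
  using leaper_strip.deg_first_rank[OF strip_flip_ranks assms] by simp

lemma no_neighbour_low: "y < s \<Longrightarrow> \<not> E (x, y) (z, y - s)"
  using move'[of x y] by force

lemma no_neighbour_high: "3 * s \<le> y \<Longrightarrow> \<not> E (x, y) (z, y + s)"
  using move'[of x y] by force

lemma deg_inner_rank:
  assumes "0 < x" "x < s" "s \<le> y" "y < 3 * s"
  shows "of_bool (E (x, y) (x - 1, y - s)) + of_bool (E (x, y) (x - 1, y + s)) +
    of_bool (E (x, y) (x + 1, y - s)) + of_bool (E (x, y) (x + 1, y + s)) = (2::int)"
proof -
  have "(\<Sum>w\<in>{(x - 1, y - s), (x - 1, y + s), (x + 1, y - s), (x + 1, y + s)}.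
      of_bool (E (x, y) w)) = (2::int)"
    by (rule deg_sum) (use move'[of x y] assms s_ge in force)+
  then show ?thesis using s_ge by (simp del: sum_of_bool_eq)
qed

text \<open>On the board of 3 ranks, if both neighbours of \<open>(1, 3)\<close> lie on rank 0, then the degrees
  force the central cycle of length 6.\<close>

lemma three_ranks_not_same_rank:
  assumes s2: "s = 2" and E3: "E (1, 3) (0, 1)" "E (1, 3) (0, 5)"
  shows False
proof -
  have low: "E (1, y) (0, y + 2)" "E (1, y) (2, y + 2)" if "0 \<le> y" "y < 2" for y
    using low_forced[of 1 y] that s2 by auto
  have high: "E (1, y) (0, y - 2)" "E (1, y) (2, y - 2)" if "6 \<le> y" "y < 8" for y
    using high_forced[of 1 y] that s2 by auto
  have neg: "\<not> E (x, y) (x', y')" if "y < 0 \<or> 8 \<le> y \<or> y' < 0 \<or> 8 \<le> y'" for x y x' y'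
    using move'[of x y x' y'] that s2 by auto
  have c: "E (0, y) (1, z) = E (1, z) (0, y)" "E (2, y) (1, z) = E (1, z) (2, y)"
    "E (2, y) (0, z) = E (0, z) (2, y)" for y z by (rule commute)+
  note first = deg_first_rank[unfolded s2] and last = deg_last_rank[unfolded s2]
    and inner = deg_inner_rank[of 1, unfolded s2]
  \<comment> \<open>Each fact comes from the degree of one cell; the last two rungs, between files 3
    and 4, close the central cycle.\<close>
  have 1: "\<not> E (1, 3) (2, 5)" "\<not> E (1, 3) (2, 1)"
    using inner[of 3] E3 by (auto simp: c of_bool_def split: if_splits)
  have 2: "E (1, 2) (0, 0)" "E (0, 0) (2, 1)"
    using first[of 0] by (auto simp: neg c of_bool_def split: if_splits)
  have 3: "E (1, 2) (2, 0)" "E (0, 1) (2, 0)"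
    using last[of 0] by (auto simp: neg c of_bool_def split: if_splits)
  have 4: "E (1, 5) (0, 7)" "E (0, 7) (2, 6)"
    using first[of 7] by (auto simp: neg c of_bool_def split: if_splits)
  have 5: "E (1, 5) (2, 7)" "E (0, 6) (2, 7)"
    using last[of 7] by (auto simp: neg c of_bool_def split: if_splits)
  have 6: "\<not> E (1, 2) (0, 4)" "\<not> E (1, 2) (2, 4)"
    using inner[of 2] 2 3 by (auto simp: c of_bool_def split: if_splits)
  have 7: "\<not> E (1, 5) (0, 3)" "\<not> E (1, 5) (2, 3)"
    using inner[of 5] 4 5 by (auto simp: c of_bool_def split: if_splits)
  have 8: "\<not> E (0, 1) (2, 2)"
    using first[of 1] E3 3 by (auto simp: neg c of_bool_def split: if_splits)
  have 9: "\<not> E (0, 5) (2, 4)" "\<not> E (0, 5) (2, 6)"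
    using first[of 5] E3 high[of 7] by (auto simp: c of_bool_def split: if_splits)
  have 10: "E (1, 4) (2, 6)"
    using last[of 6] 9 by (auto simp: neg c of_bool_def split: if_splits)
  have 11: "E (0, 3) (2, 4)"
    using last[of 4] 9 6 by (auto simp: c of_bool_def split: if_splits)
  have 12: "\<not> E (0, 3) (2, 2)"
    using first[of 3] 11 low[of 1] by (auto simp: c of_bool_def split: if_splits)
  have 13: "E (1, 4) (2, 2)"
    using last[of 2] 8 12 by (auto simp: c of_bool_def split: if_splits)
  have 14: "\<not> E (1, 4) (0, 6)"
    using inner[of 4] 10 13 by (auto simp: c of_bool_def split: if_splits)
  have 15: "E (0, 6) (2, 5)"
    using first[of 6] 14 by (auto simp: neg c of_bool_def split: if_splits)
  have 16: "\<not> E (0, 4) (2, 5)"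
    using last[of 5] 15 high[of 7] by (auto simp: c of_bool_def split: if_splits)
  have "E (0, 4) (2, 3)"
    using first[of 4] 16 6 by (auto simp: c of_bool_def split: if_splits)
  then show False using no_zig_cycle[of 3] 11 s2 by (simp add: c)
qed

text \<open>Both neighbours of \<open>(1, 3)\<close> on one rank are excluded for rank 0 and, by
  reflection, for rank 2.\<close>

lemma three_ranks_exchange:
  assumes s2: "s = 2"
  shows "E (1, 3) (0, 1) \<noteq> E (1, 3) (0, 5)"
proof -
  have "\<not> (E (1, 3) (2, 1) \<and> E (1, 3) (2, 5))"
    using leaper_strip.three_ranks_not_same_rank[OF strip_flip_ranks s2] s2 by auto
  then show ?thesis
    using deg_inner_rank[of 1 3, unfolded s2] three_ranks_not_same_rank[OF s2]
    by (auto simp: of_bool_def split: if_splits)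
qed

text \<open>If \<open>4 \<le> s\<close>, then exactly one of the two neighbours of \<open>(1, y + s)\<close> on rank 2 is joined to it, by
  forced edges.\<close>

lemma level_exchange_first_rank:
  assumes y: "0 \<le> y" "y < 2 * s"
  shows "E (0, y) (1, y + s) \<noteq> E (0, y + 2 * s) (1, y + s)"
proof (cases "s = 2")
  case False
  then have "4 \<le> s" using s_ge s_even by presburger
  have deg: "of_bool (E (1, y + s) (0, y)) + of_bool (E (1, y + s) (0, y + 2 * s)) +
      of_bool (E (1, y + s) (2, y)) + of_bool (E (1, y + s) (2, y + 2 * s)) = (2::int)"
    using deg_inner_rank[of 1 "y + s"] y s_ge by (simp add: algebra_simps)
  have "E (1, y + s) (2, y) \<noteq> E (1, y + s) (2, y + 2 * s)"
  proof (cases "y < s")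
    case True
    have "E (2, y) (1, y + s)" using low_forced[of 2 y] y True \<open>4 \<le> s\<close> by simp
    moreover have "E (1, y + 3 * s) (2, y + 2 * s)" "E (3, y + 3 * s) (2, y + 2 * s)"
      using high_forced[of 1 "y + 3 * s"] high_forced[of 3 "y + 3 * s"] y True \<open>4 \<le> s\<close>
      by (simp_all add: algebra_simps)
    then have "\<not> E (2, y + 2 * s) (1, y + s)"
      using no_third[of "(2, y + 2 * s)" "(1, y + 3 * s)" "(3, y + 3 * s)" "(1, y + s)"] s_ge
      by (auto simp: commute[of "(2, y + 2 * s)"])
    ultimately show ?thesis by (simp add: commute[of "(1, y + s)"])
  next
    case False
    have "E (2, y + 2 * s) (1, y + s)"
      using high_forced[of 2 "y + 2 * s"] y False \<open>4 \<le> s\<close> by (simp add: algebra_simps)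
    moreover have "E (1, y - s) (2, y)" "E (3, y - s) (2, y)"
      using low_forced[of 1 "y - s"] low_forced[of 3 "y - s"] y False \<open>4 \<le> s\<close> by simp_all
    then have "\<not> E (2, y) (1, y + s)"
      using no_third[of "(2, y)" "(1, y - s)" "(3, y - s)" "(1, y + s)"] s_ge
      by (auto simp: commute[of "(2, y)"])
    ultimately show ?thesis by (simp add: commute[of "(1, y + s)"])
  qed
  then show ?thesis using deg by (auto simp: of_bool_def commute[of "(1, y + s)"] split: if_splits)
next
  case s2: True
  have neg: "\<not> E (x, y) (x', y')" if "y < 0 \<or> 8 \<le> y \<or> y' < 0 \<or> 8 \<le> y'" for x y x' y'
    using move'[of x y x' y'] that s2 by auto
  have c: "E (0, y) (1, z) = E (1, z) (0, y)" "E (2, y) (1, z) = E (1, z) (2, y)" for y z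
    by (rule commute)+
  \<comment> \<open>For \<open>y = 0\<close> and \<open>y = 3\<close> the corners force both edges
    of the middle cell; \<open>y = 2\<close> is the reflection of \<open>y = 1\<close>.\<close>
  consider "y = 0" | "y = 1" | "y = 2" | "y = 3" using y s2 by linarith
  then have "E (1, y + 2) (0, y) \<noteq> E (1, y + 2) (0, y + 4)"
  proof cases
    case 1
    have "E (1, 2) (0, 0)" "E (1, 2) (2, 0)"
      using deg_first_rank[of 0, unfolded s2] deg_last_rank[of 0, unfolded s2]
      by (auto simp: neg c of_bool_def split: if_splits)
    then show ?thesis
      using deg_inner_rank[of 1 2, unfolded s2] 1 by (auto simp: of_bool_def split: if_splits)
  next
    case 2
    then show ?thesis using three_ranks_exchange[OF s2] by simp
  next
    case 3
    then show ?thesis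
      using leaper_strip.three_ranks_exchange[OF strip_flip_files s2] s2 by simp
  next
    case 4
    have "E (1, 5) (0, 7)" "E (1, 5) (2, 7)"
      using deg_first_rank[of 7, unfolded s2] deg_last_rank[of 7, unfolded s2]
      by (auto simp: neg c of_bool_def split: if_splits)
    then show ?thesis
      using deg_inner_rank[of 1 5, unfolded s2] 4 by (auto simp: of_bool_def split: if_splits)
  qed
  then show ?thesis using s2 by (simp add: c)
qed

text \<open>The two cells have total degree 4. Two of these edges go to rank 1: one forced, and
  exactly one to \<open>(1, y + s)\<close> by the exchange lemma. The remaining two are
  rungs.\<close>

lemma rungs_first_rank:
  assumes y: "0 \<le> y" "y < 2 * s"
  shows "of_bool (E (0, y) (s, y - 1)) + of_bool (E (0, y) (s, y + 1)) +
    of_bool (E (0, y + 2 * s) (s, y + 2 * s - 1)) + of_bool (E (0, y + 2 * s) (s, y + 2 * s + 1)) = (2::int)"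
proof (cases "y < s")
  case True
  then have "E (0, y + 2 * s) (1, y + 3 * s)"
    using high_forced[of 1 "y + 3 * s"] y s_ge by (auto simp: algebra_simps commute[of "(0, _)"])
  then show ?thesis
    using deg_first_rank[of y] deg_first_rank[of "y + 2 * s"] level_exchange_first_rank[OF y]
      no_neighbour_low[OF True] y
    by (auto simp: of_bool_def algebra_simps split: if_splits)
next
  case False
  then have "E (0, y) (1, y - s)"
    using low_forced[of 1 "y - s"] y s_ge by (auto simp: commute[of "(0, _)"])
  then show ?thesis
    using deg_first_rank[of y] deg_first_rank[of "y + 2 * s"] level_exchange_first_rank[OF y]
      no_neighbour_high[of "y + 2 * s" 0 1] y False
    by (auto simp: of_bool_def algebra_simps split: if_splits)
qed

lemma rungs_last_rank:
  assumes y: "0 \<le> y" "y < 2 * s"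
  shows "of_bool (E (s, y) (0, y - 1)) + of_bool (E (s, y) (0, y + 1)) +
    of_bool (E (s, y + 2 * s) (0, y + 2 * s - 1)) + of_bool (E (s, y + 2 * s) (0, y + 2 * s + 1)) = (2::int)"
  using leaper_strip.rungs_first_rank[OF strip_flip_ranks y] by simp

text \<open>The moves between ranks 0 and \<open>s\<close> form two disjoint paths, distinguished by the parity of the
  files at which they visit rank 0; \<open>p\<close> selects one of them.\<close>

definition rung :: "bool \<Rightarrow> int \<Rightarrow> bool" where
  "rung p y \<longleftrightarrow> E (if even y = p then 0 else s, y) (if even y = p then s else 0, y + 1)"

lemma rung_prev: "rung p (y - 1) \<longleftrightarrow> E (if even y = p then 0 else s, y) (if even y = p then s else 0, y - 1)"
  unfolding rung_def by (subst commute) auto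

lemma rung_neg: "y < 0 \<Longrightarrow> \<not> rung p y"
  using move'[of _ y] unfolding rung_def by force

text \<open>As \<open>2 * s\<close> is even, a path meets the files \<open>y\<close> and
  \<open>y + 2 * s\<close> on the same rank, so one of the two preceding relations applies.\<close>

lemma rung_sum:
  assumes "0 \<le> y" "y < 2 * s"
  shows "of_bool (rung p (y - 1)) + of_bool (rung p y) +
    of_bool (rung p (y + 2 * s - 1)) + of_bool (rung p (y + 2 * s)) = (2::int)"
  using rungs_first_rank[OF assms] rungs_last_rank[OF assms]
  unfolding rung_prev by (simp add: rung_def)

text \<open>A cell on the lowest \<open>s\<close> files has just three possible neighbours, two of
  them along rungs; if a rung is absent, the third is used. This supplies end edges for
  \<open>zag\<close>.\<close>

lemma rung_end:
  assumes "0 \<le> y" "y < s" "\<not> (rung p (y - 1) \<and> rung p y)"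
  shows "if even y = p then E (0, y) (1, y + s) else E (s, y) (s - 1, y + s)"
  using deg_first_rank[of y] deg_last_rank[of y] no_neighbour_low[of y 0 1]
    no_neighbour_low[of y s "s - 1"] assms
  unfolding rung_prev by (auto simp: rung_def of_bool_def split: if_splits)

text \<open>Two rungs exhaust the degree at file \<open>y\<close>, so the exchange lemma moves the
  edge to file \<open>y + 2 * s\<close>.\<close>

lemma rung_end':
  assumes "0 \<le> y" "y < s" "rung p (y - 1)" "rung p y"
  shows "if even y = p then E (0, y + 2 * s) (1, y + s) else E (s, y + 2 * s) (s - 1, y + s)"
proof -
  have "\<not> E (0, y) (1, y + s)" if "even y = p"
    using that deg_first_rank[of y] no_neighbour_low[of y 0 1] assms
    unfolding rung_prev by (auto simp: rung_def of_bool_def split: if_splits)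
  moreover have "\<not> E (s, y) (s - 1, y + s)" if "even y \<noteq> p"
    using that deg_last_rank[of y] no_neighbour_low[of y s "s - 1"] assms
    unfolding rung_prev by (auto simp: rung_def of_bool_def split: if_splits)
  ultimately show ?thesis
    using level_exchange_first_rank[of y]
      leaper_strip.level_exchange_first_rank[OF strip_flip_ranks, of y] assms by auto
qed

section \<open>Rung patterns and the final contradiction\<close>

text \<open>Without the rung at \<open>2 * s - 1\<close>, \<open>rung_sum\<close> at 0 forces the
  rungs at 0 and \<open>2 * s\<close>. By induction, both rungs at \<open>y\<close> and
  \<open>y + 2 * s\<close> present makes both at the next files absent, and conversely.\<close>

lemma rungs_alternate:
  assumes "\<not> rung p (2 * s - 1)" "0 \<le> y" "y < 2 * s"
  shows "(rung p y \<longleftrightarrow> even y) \<and> (rung p (y + 2 * s) \<longleftrightarrow> even y)"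
  using assms(2,3)
proof (induction y rule: int_ge_induct)
  case base
  then show ?case using rung_sum[of 0 p] rung_neg[of "-1" p] assms(1)
    by (auto simp: of_bool_def split: if_splits)
next
  case (step y)
  then show ?case using rung_sum[of "y + 1" p]
    by (auto simp: of_bool_def algebra_simps split: if_splits)
qed

lemma rungs_complementary:
  assumes "rung p (2 * s - 1)" "0 \<le> y" "y < 2 * s"
  shows "rung p (y + 2 * s) \<longleftrightarrow> \<not> rung p y"
  using assms(2,3)
proof (induction y rule: int_ge_induct)
  case base
  then show ?case using rung_sum[of 0 p] rung_neg[of "-1" p] assms(1)
    by (auto simp: of_bool_def split: if_splits)
next
  case (step y)
  then show ?case using rung_sum[of "y + 1" p]
    by (auto simp: of_bool_def algebra_simps split: if_splits)
qed

lemma not_both_rungs_inner: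
  assumes "s \<le> y" "y + 1 < 3 * s" shows "\<not> (rung True y \<and> rung False y)"
  using no_zig_cycle[OF assms] by (auto simp: rung_def split: if_splits)

text \<open>With no adjacent rungs, \<open>rung_end\<close> supplies all end edges of two
  \<open>zag\<close> paths, which the two rungs close to a cycle.\<close>

lemma not_both_rungs_isolated:
  assumes "0 \<le> y" "y + 1 < s" "rung True y" "rung False y"
  shows "rung True (y - 1) \<or> rung False (y - 1) \<or> rung True (y + 1) \<or> rung False (y + 1)"
proof (rule ccontr)
  assume "\<not> ?thesis"
  then show False
    using no_zag_cycle[OF assms(1,2)] assms rung_end[of y True] rung_end[of y False]
      rung_end[of "y + 1" True] rung_end[of "y + 1" False]
    by (auto simp: rung_def split: if_splits)
qed

lemma not_both_rungs_middle:
  "\<not> (rung True (2 * s - 1) \<and> rung False (2 * s - 1))"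
  using not_both_rungs_inner[of "2 * s - 1"] s_ge by auto

lemma some_rung_middle: "rung True (2 * s - 1) \<or> rung False (2 * s - 1)"
proof (rule ccontr)
  assume "\<not> ?thesis"
  then have "\<And>p. \<not> rung p (2 * s - 1)" by (metis (full_types))
  from rungs_alternate[OF this, of 0] rungs_alternate[OF this, of 1] show False
    using not_both_rungs_isolated[of 0] rung_neg[of "-1"] s_ge by auto
qed

text \<open>Two consecutive rungs at odd files of the first path that are both absent or both present would each
  close a short cycle, since the second path has no rung at odd files.\<close>

lemma odd_rungs_alternate:
  assumes mid: "rung True (2 * s - 1)" "\<not> rung False (2 * s - 1)"
    and "0 \<le> i" "2 * i - 1 < s"
  shows "rung True (2 * i - 1) \<longleftrightarrow> odd i"
  using assms(3,4)
proof (induction i rule: int_ge_induct)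
  case base
  then show ?case using rung_neg by simp
next
  case (step i)
  define c where "c = 2 * i"
  have c: "0 \<le> c" "c + 1 < s" "even c" using step by (auto simp: c_def)
  have False_rungs: "rung False c" "rung False (c + 2 * s)" "\<not> rung False (c + 1)"
    using rungs_alternate[OF mid(2), of c] rungs_alternate[OF mid(2), of "c + 1"] c by auto
  have prev: "\<not> rung False (c - 1)"
  proof (cases "c = 0")
    case True then show ?thesis using rung_neg by simp
  next
    case False
    then show ?thesis using rungs_alternate[OF mid(2), of "c - 1"] c by auto
  qed
  \<comment> \<open>A rung of the first path here would close a \<open>zig\<close> cycle with that
    of the second, so by complementarity it is at \<open>c\<close> instead.\<close>
  have "\<not> rung True (c + 2 * s)"
    using not_both_rungs_inner[of "c + 2 * s"] False_rungs c by auto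
  then have True_rung: "rung True c" using rungs_complementary[OF mid(1), of c] c by auto
  have "rung True (c - 1) \<or> rung True (c + 1)"
    using not_both_rungs_isolated[of c] False_rungs True_rung prev c by auto
  moreover have "\<not> (rung True (c - 1) \<and> rung True (c + 1))"
  \<comment> \<open>Two rungs of the first path at each of the files \<open>c\<close> and
    \<open>c + 1\<close> shift its \<open>zag\<close> ends by \<open>2 * s\<close>, as
    \<open>no_zig_zag_cycle\<close> requires.\<close>
  proof
    assume "rung True (c - 1) \<and> rung True (c + 1)"
    then show False
      using no_zig_zag_cycle[OF c(1,2)] False_rungs prev c True_rung s_even
        rung_end'[of c True] rung_end[of c False] rung_end'[of "c + 1" True] rung_end[of "c + 1" False]
      by (auto simp: rung_def algebra_simps)
  qed
  moreover have "rung True (c - 1) \<longleftrightarrow> odd i" using step by (simp add: c_def)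
  ultimately have "rung True (c + 1) \<longleftrightarrow> odd (i + 1)" by auto
  moreover have "2 * (i + 1) - 1 = c + 1" by (simp add: c_def)
  ultimately show ?case by (simp only:)
qed

lemma middle_rungs_contradiction:
  assumes "rung True (2 * s - 1)" "\<not> rung False (2 * s - 1)"
  shows False
proof -
  define E' where "E' u v = E (s - fst u, 4 * s - 1 - snd u) (s - fst v, 4 * s - 1 - snd v)" for u v
  have strip': "leaper_strip s E'"
    using leaper_strip.strip_flip_ranks[OF strip_flip_files] by (simp add: E'_def[abs_def])
  \<comment> \<open>The half turn flips both the rank and the file parity, so each path is mapped to
    itself.\<close>
  have rung': "leaper_strip.rung s E' p y \<longleftrightarrow> rung p (4 * s - 2 - y)" for p y
    unfolding leaper_strip.rung_def[OF strip'] rung_def E'_def using s_even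
    by (subst commute) (auto simp: algebra_simps)
  obtain i where i: "s = 2 * i" using s_even by blast
  have "rung True (s - 1) \<longleftrightarrow> odd i"
    using odd_rungs_alternate[OF assms, of i] i s_ge by simp
  moreover have "leaper_strip.rung s E' True (2 * s - 1)" "\<not> leaper_strip.rung s E' False (2 * s - 1)"
    using assms by (simp_all add: rung')
  \<comment> \<open>By periodicity at both ends, the rungs at \<open>s - 1\<close> and
    \<open>3 * s - 1\<close> are both present or both absent, against complementarity.\<close>
  then have "leaper_strip.rung s E' True (2 * i - 1) \<longleftrightarrow> odd i"
    by (rule leaper_strip.odd_rungs_alternate[OF strip']) (use s_ge i in simp_all)
  then have "rung True (4 * s - 2 - (2 * i - 1)) \<longleftrightarrow> odd i" unfolding rung' .
  moreover have "4 * s - 2 - (2 * i - 1) = 3 * s - 1" using i by simp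
  moreover have "rung True (3 * s - 1) \<longleftrightarrow> \<not> rung True (s - 1)"
    using rungs_complementary[OF assms(1), of "s - 1"] s_ge by (simp add: algebra_simps)
  ultimately show False by simp
qed

text \<open>Exactly one path has the middle rung; a reflection of the ranks swaps the paths.\<close>

lemma no_strip_tour: False
proof -
  define E' where "E' u v = E (s - fst u, snd u) (s - fst v, snd v)" for u v
  have strip': "leaper_strip s E'"
    using strip_flip_ranks by (simp add: E'_def[abs_def])
  have rung': "leaper_strip.rung s E' p y \<longleftrightarrow> rung (\<not> p) y" for p y
    unfolding leaper_strip.rung_def[OF strip'] rung_def E'_def by auto
  show False
    using middle_rungs_contradiction leaper_strip.middle_rungs_contradiction[OF strip']
      some_rung_middle not_both_rungs_middle by (auto simp: rung')
qed

end

section \<open>Case distinction on the size of the board\<close>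

lemma no_leaper_tour_ranks_le_files:
  assumes "leaper_tour s m n E" "0 < m" "m \<le> n" "m * n < (2 * s + 1) * (2 * s + 2)"
  shows False
proof -
  interpret leaper_tour s m n E by (rule assms)
  have "s < m" using more_ranks_than_s assms by blast
  have "m \<noteq> 2 * s" using not_double_width s_ge \<open>m \<le> n\<close> by auto
  have "n \<noteq> 2 * s"
    using leaper_tour.not_double_width[OF leaper_tour_transpose[OF assms(1)]] \<open>s < m\<close> s_ge by auto
  have even: "even (m * n)"
    using even_card assms by (simp add: card_cartesian_product nat_mult_distrib[symmetric] even_nat_iff)
  show False
  proof (cases "2 * s < m")
    case True
    then have "2 * s + 1 \<le> m" "2 * s + 1 \<le> n" using \<open>m \<le> n\<close> by auto
    have "n < 2 * s + 2"
    proof (rule ccontr)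
      assume "\<not> n < 2 * s + 2"
      then have "(2 * s + 1) * (2 * s + 2) \<le> m * n"
        using \<open>2 * s + 1 \<le> m\<close> s_ge by (intro mult_mono) auto
      then show False using assms by simp
    qed
    then have "m = 2 * s + 1" "n = 2 * s + 1" using True \<open>m \<le> n\<close> by auto
    then show False using even by simp
  next
    case False
    then have m: "m < 2 * s" using \<open>m \<noteq> 2 * s\<close> by simp
    then have "2 * s < n"
      using not_both_narrow \<open>s < m\<close> \<open>m \<le> n\<close> \<open>n \<noteq> 2 * s\<close> by fastforce
    then have n: "4 * s \<le> n" using not_three_files[OF \<open>s < m\<close> m] by (metis not_le)
    have "m = s + 1"
    proof (rule ccontr)
      assume "m \<noteq> s + 1"
      then have "(s + 2) * (4 * s) \<le> m * n"
        using \<open>s < m\<close> n s_ge by (intro mult_mono) auto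
      then have "(s + 2) * (4 * s) < (2 * s + 1) * (2 * s + 2)" using assms by linarith
      then show False using s_ge by (simp add: algebra_simps)
    qed
    \<comment> \<open>With \<open>m = s + 1\<close>, the value \<open>n = 4 * s + 2\<close> meets
      the area bound exactly; \<open>4 * s + 1\<close> is left to parity.\<close>
    have "n < 4 * s + 2"
    proof (rule ccontr)
      assume "\<not> n < 4 * s + 2"
      then have "(s + 1) * (4 * s + 2) \<le> m * n"
        using \<open>m = s + 1\<close> s_ge by (intro mult_mono) auto
      then show False using assms by (simp add: algebra_simps)
    qed
    moreover have "even n" using even \<open>m = s + 1\<close> s_even by simp
    ultimately have "n = 4 * s" using n by presburger
    then have "leaper_strip s E"
      using assms(1) \<open>m = s + 1\<close> by (simp add: leaper_strip_def)
    then show False by (rule leaper_strip.no_strip_tour)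
  qed
qed

lemma no_leaper_tour:
  assumes "leaper_tour s m n E" "0 < m" "0 < n" "m * n < (2 * s + 1) * (2 * s + 2)"
  shows False
  using no_leaper_tour_ranks_le_files[OF assms(1)]
    no_leaper_tour_ranks_le_files[OF leaper_tour_transpose[OF assms(1)]] assms
  by (cases "m \<le> n") (auto simp: mult.commute)

section \<open>From Hamiltonian circuits to tours\<close>

lemma card_cyclic_neighbours:
  fixes c :: "nat \<Rightarrow> 'a" and L :: nat
  assumes "3 \<le> L" and c: "\<And>i j. c i = c j \<longleftrightarrow> i mod L = j mod L"
  shows "card {w. \<exists>j. c i = c j \<and> w = c (Suc j) \<or> w = c j \<and> c i = c (Suc j)} = 2"
proof -
  obtain k where k: "i mod L = Suc k mod L" and k2: "c i = c (Suc k)"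
  proof
    \<comment> \<open>The predecessor of \<open>i\<close> is taken as \<open>i + L - 1\<close>, so
      that \<open>i = 0\<close> causes no truncation.\<close>
    show "i mod L = Suc (i + L - 1) mod L" using assms(1) by simp
    then show "c i = c (Suc (i + L - 1))" by (simp add: c)
  qed
  have Suc_inj: "j mod L = j' mod L" if "Suc j mod L = Suc j' mod L" for j j'
  proof -
    have "(Suc j + (L - 1)) mod L = (Suc j' + (L - 1)) mod L" using that by (metis mod_add_left_eq)
    then show ?thesis using assms(1) by simp
  qed
  have "{w. \<exists>j. c i = c j \<and> w = c (Suc j) \<or> w = c j \<and> c i = c (Suc j)} = {c (Suc (Suc k)), c k}"
  proof (intro equalityI subsetI)
    fix w assume "w \<in> {w. \<exists>j. c i = c j \<and> w = c (Suc j) \<or> w = c j \<and> c i = c (Suc j)}"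
    then obtain j where "Suc k mod L = j mod L \<and> w = c (Suc j) \<or> w = c j \<and> Suc k mod L = Suc j mod L"
      using k by (auto simp: c)
    then show "w \<in> {c (Suc (Suc k)), c k}"
      using Suc_inj[of k j] by (auto simp: c) (metis mod_Suc_eq)+
  next
    fix w assume "w \<in> {c (Suc (Suc k)), c k}"
    then show "w \<in> {w. \<exists>j. c i = c j \<and> w = c (Suc j) \<or> w = c j \<and> c i = c (Suc j)}"
      using k2 by auto
  qed
  moreover have "c (Suc (Suc k)) \<noteq> c k"
  proof
    assume "c (Suc (Suc k)) = c k"
    then have "L dvd Suc (Suc k) - k" by (metis c mod_eq_dvd_iff_nat le_SucI le_refl)
    then show False using assms(1) by (auto dest: dvd_imp_le)
  qed
  ultimately show ?thesis by simp
qed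

lemma cyclic_closed:
  fixes c :: "nat \<Rightarrow> 'a" and L :: nat
  assumes "0 < L" and c: "\<And>i j. c i = c j \<longleftrightarrow> i mod L = j mod L"
    and "c i \<in> S" and step: "\<And>j. c j \<in> S \<Longrightarrow> c (Suc j) \<in> S"
  shows "c j \<in> S"
proof -
  have "c (i + d) \<in> S" for d
    using assms(3) step by (induction d) auto
  \<comment> \<open>Only forward steps are available, so the target is moved to
    \<open>j + i * L\<close>, which is at least \<open>i\<close>.\<close>
  from this[of "j + i * L - i"] have "c (j + i * L) \<in> S" using assms(1) by (simp add: trans_le_add2)
  moreover have "c (j + i * L) = c j" by (simp add: c)
  ultimately show ?thesis by simp
qed

lemma (in pre_digraph) cas_nth:
  "cas u p v \<Longrightarrow> Suc i < length p \<Longrightarrow> head G (p ! i) = tail G (p ! Suc i)"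
proof (induction p arbitrary: u i)
  case (Cons e p)
  then show ?case by (cases i; cases p) auto
qed simp

lemma (in pre_digraph) cas_last: "cas u p v \<Longrightarrow> p \<noteq> [] \<Longrightarrow> head G (last p) = v"
  by (induction p arbitrary: u) auto

lemma (in pre_digraph) cycle_enumeration:
  assumes "cycle p"
  obtains c where "\<And>i j. c i = c j \<longleftrightarrow> i mod length p = j mod length p"
    and "range c = set (map (tail G) p)"
    and "\<And>i. \<exists>e\<in>arcs G. tail G e = c i \<and> head G e = c (Suc i)"
proof -
  let ?L = "length p"
  obtain u where u: "awalk u p u" "distinct (tl (awalk_verts u p))" "p \<noteq> []"
    using assms by (auto simp: cycle_def)
  then have cas: "cas u p u" and sub: "set p \<subseteq> arcs G" by (auto simp: awalk_def)
  have dist: "distinct (map (head G) p)" using u awalk_verts_conv'[OF cas] by simp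
  define c where "c i = tail G (p ! (i mod ?L))" for i
  have L: "0 < ?L" using u by simp
  have head: "head G (p ! (i mod ?L)) = c (Suc i)" for i
  proof (cases "Suc (i mod ?L) = ?L")
    case True
    then have "Suc i mod ?L = 0" by (simp add: mod_Suc)
    moreover have "head G (last p) = tail G (hd p)"
      using cas u(3) cas_last[OF cas] by (simp add: cas_simp)
    moreover have "last p = p ! (i mod ?L)" using u(3) True by (metis last_conv_nth diff_Suc_1)
    ultimately show ?thesis using u(3) by (simp add: c_def hd_conv_nth)
  next
    case False
    then have "Suc (i mod ?L) < ?L" using L by (metis Suc_lessI mod_less_divisor)
    then show ?thesis using cas_nth[OF cas, of "i mod ?L"] False by (simp add: c_def mod_Suc)
  qed
  show thesis
  proof
    show "c i = c j \<longleftrightarrow> i mod ?L = j mod ?L" for i j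
    proof
      assume eq: "c i = c j"
      \<comment> \<open>The cycle condition gives distinct heads, whereas \<open>c\<close> lists
        tails, so the preceding arcs are compared.\<close>
      let ?i = "i + ?L - 1" and ?j = "j + ?L - 1"
      have "Suc ?i = i + ?L" "Suc ?j = j + ?L" using L by auto
      then have "head G (p ! (?i mod ?L)) = head G (p ! (?j mod ?L))"
        using eq unfolding head by (simp add: c_def)
      then have "map (head G) p ! (?i mod ?L) = map (head G) p ! (?j mod ?L)" using L by simp
      then have "?i mod ?L = ?j mod ?L"
        using nth_eq_iff_index_eq[OF dist] L by simp
      then have "Suc ?i mod ?L = Suc ?j mod ?L" by (metis mod_Suc_eq)
      then show "i mod ?L = j mod ?L" using L by simp
    qed (simp add: c_def)
    show "range c = set (map (tail G) p)"
    proof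
      show "range c \<subseteq> set (map (tail G) p)" using L by (auto simp: c_def)
      show "set (map (tail G) p) \<subseteq> range c"
      proof
        fix v assume "v \<in> set (map (tail G) p)"
        then obtain i where "i < ?L" "v = tail G (p ! i)" by (auto simp: in_set_conv_nth)
        then have "v = c i" by (simp add: c_def)
        then show "v \<in> range c" by simp
      qed
    qed
    show "\<exists>e\<in>arcs G. tail G e = c i \<and> head G e = c (Suc i)" for i
      using head[of i] sub L by (intro bexI[of _ "p ! (i mod ?L)"]) (auto simp: c_def)
  qed
qed

lemma hamiltonian_circuit_leaper_tour:
  assumes "0 < k" and ham: "hamiltonian_circuit (with_proj (leaper_graph 1 (2 * k) m n)) p"
  shows "\<exists>E. leaper_tour (2 * int k) (int m) (int n) E"
proof -
  let ?G = "with_proj (leaper_graph 1 (2 * k) m n)"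
  let ?V = "{0..<int m} \<times> {0..<int n}"
  have len: "3 \<le> length p" and cyc: "pre_digraph.cycle ?G p"
    and V: "set (map (tail ?G) p) = ?V"
    using ham by (auto simp: hamiltonian_circuit_def leaper_graph_def Let_def)
  obtain c where c: "\<And>i j. c i = c j \<longleftrightarrow> i mod length p = j mod length p"
    and range: "range c = ?V"
    and arc: "\<And>i. \<exists>e\<in>arcs ?G. tail ?G e = c i \<and> head ?G e = c (Suc i)"
    by (rule pre_digraph.cycle_enumeration[OF cyc, unfolded V]) (rule that)
  have arc': "(c i, c (Suc i)) \<in> parcs (leaper_graph 1 (2 * k) m n)" for i
    using arc[of i] by (metis with_proj_simps(2,4,5) prod.collapse)
  \<comment> \<open>Only the edges used by the circuit are kept, which makes every degree 2.\<close>
  define E where "E u v \<longleftrightarrow> (\<exists>i. u = c i \<and> v = c (Suc i) \<or> v = c i \<and> u = c (Suc i))" for u v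
  have "leaper_tour (2 * int k) (int m) (int n) E"
  proof
    show "E v u" if "E u v" for u v using that by (auto simp: E_def)
    show "0 \<le> x \<and> x < int m \<and> 0 \<le> y \<and> y < int n \<and>
        (\<bar>x' - x\<bar> = 1 \<and> \<bar>y' - y\<bar> = 2 * int k \<or> \<bar>x' - x\<bar> = 2 * int k \<and> \<bar>y' - y\<bar> = 1)"
      if "E (x, y) (x', y')" for x y x' y'
    proof -
      have "((x, y), (x', y')) \<in> parcs (leaper_graph 1 (2 * k) m n) \<or>
          ((x', y'), (x, y)) \<in> parcs (leaper_graph 1 (2 * k) m n)"
        using that arc' unfolding E_def by metis
      then show ?thesis
        by (auto simp: leaper_graph_def Let_def leaper_moves_def)
    qed
    show "card {w. E (x, y) w} = 2" if "0 \<le> x" "x < int m" "0 \<le> y" "y < int n" for x y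
    proof -
      have "(x, y) \<in> range c" using range that by simp
      then obtain i where "(x, y) = c i" by blast
      then show ?thesis
        using card_cyclic_neighbours[OF len c, of i] by (simp add: E_def)
    qed
    show "?V \<subseteq> S" if u: "u \<in> S" "u \<in> ?V" and S: "\<And>v w. v \<in> S \<Longrightarrow> E v w \<Longrightarrow> w \<in> S" for u S
    proof -
      obtain i where i: "c i \<in> S" using u range by (metis rangeE)
      have "c (Suc j) \<in> S" if "c j \<in> S" for j by (rule S[OF that]) (auto simp: E_def)
      moreover have "0 < length p" using len by linarith
      ultimately have "c j \<in> S" for j using cyclic_closed[OF _ c i] by blast
      then have "range c \<subseteq> S" by blast
      then show ?thesis unfolding range .
    qed
  qed (use assms(1) in auto)
  then show ?thesis by blast
qed

theorem theorem7:
  fixes k m n :: nat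
  assumes "k > 0" "m > 0" "n > 0"
    and "m * n < (4 * k + 1) * (4 * k + 2)"
  shows "\<not> (\<exists>p. hamiltonian_circuit (with_proj (leaper_graph 1 (2 * k) m n)) p)"
proof
  assume "\<exists>p. hamiltonian_circuit (with_proj (leaper_graph 1 (2 * k) m n)) p"
  then obtain E where E: "leaper_tour (2 * int k) (int m) (int n) E"
    using hamiltonian_circuit_leaper_tour assms(1) by blast
  have "int (m * n) < int ((4 * k + 1) * (4 * k + 2))" using assms(4) by (simp only: of_nat_less_iff)
  then have "int m * int n < (2 * (2 * int k) + 1) * (2 * (2 * int k) + 2)" by (simp add: algebra_simps)
  then show False using no_leaper_tour[OF E] assms by simp
qed

end
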